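(* Let $(\Xi_n)_{n\ge 0}$ be the diminishing segment process started from $\Xi_0=[-1,1]$, and let $\rho_n$ be the radius (half-length) of $\Xi_n$. Then, as $n\to\infty$, \[ n\left(\rho_n-\frac12\right)\ \text{converges in distribution to}\ \mathrm{Exp}(4), \] where $\mathrm{Exp}(4)$ is the exponential law with rate $4$, i.e. with tail $x\mapsto e^{-4x}$ for $x\ge 0$. Moreover, for every integer $k\ge 1$, \[ \lim_{n\to\infty}\mathbb{E}\left[n^k\left(\rho_n-\frac12\right)^k\right]=\frac{k!}{4^k}. \]
   Context: The diminishing segment process is the following random sequence of closed segments of $\mathbb{R}$. Let $\Xi_0=[-1,1]$. For every $n=0,1,2,\dots$, given the first $n$ steps (i.e. given $a_1,\dots,a_n$, which determine $\Xi_0,\dots,\Xi_n$), choose a random point $a_{n+1}$ with uniform distribution on $\Xi_n$, and set \[ \Xi_{n+1}=\Xi_n\cap[a_{n+1}-1,\,a_{n+1}+1]. \] Write $\Xi_n=[Z_n-\rho_n,\,Z_n+\rho_n]$, so that $Z_n$ is the centre and $\rho_n$ is the radius of $\Xi_n$; in particular $Z_0=0$ and $\rho_0=1$. *)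

theory Defs
  imports "HOL-Probability.Probability"
begin

text \<open>
  Points are indexed from 1 as \<open>a\<^sub>1, a\<^sub>2, \<dots>\<close>; the value \<open>a 0\<close> is never used.
\<close>

primrec segment :: "(nat \<Rightarrow> real) \<Rightarrow> nat \<Rightarrow> real set" where
  "segment a 0 = {-1..1}"
| "segment a (Suc n) = segment a n \<inter> {a (Suc n) - 1 .. a (Suc n) + 1}"

definition segment_center :: "(nat \<Rightarrow> real) \<Rightarrow> nat \<Rightarrow> real" where
  "segment_center a n = (Sup (segment a n) + Inf (segment a n)) / 2"

definition segment_radius :: "(nat \<Rightarrow> real) \<Rightarrow> nat \<Rightarrow> real" where
  "segment_radius a n = (Sup (segment a n) - Inf (segment a n)) / 2"

lemma segment_eq_center_radius:
  assumes "segment a n \<noteq> {}"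
  shows "segment a n =
    {segment_center a n - segment_radius a n .. segment_center a n + segment_radius a n}"
proof -
  have "\<exists>l u. segment a n = {l..u}"
  proof (induction n)
    case (Suc n)
    then show ?case by (metis Int_atLeastAtMost segment.simps(2))
  qed auto
  then obtain l u where lu: "segment a n = {l..u}" by blast
  with assms have "l \<le> u" by auto
  then show ?thesis
    unfolding segment_center_def segment_radius_def lu by (simp add: field_simps)
qed

text \<open>
  The conditional law of \<open>a\<^sub>n\<^sub>+\<^sub>1\<close> given the \<open>\<sigma>\<close>-algebra generated by
  \<open>a\<^sub>1, \<dots>, a\<^sub>n\<close> (trivial for \<open>n = 0\<close>) is the uniform distribution on the \<open>n\<close>-th segment.
\<close>

locale diminishing_segment_process = prob_space M
  for M :: "'w measure" and a :: "nat \<Rightarrow> 'w \<Rightarrow> real" +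
  assumes point_measurable: "\<And>n. n \<ge> 1 \<Longrightarrow> random_variable borel (a n)"
    and point_uniform: "\<And>n B. B \<in> sets borel \<Longrightarrow>
      AE \<omega> in M.
        real_cond_exp M
          (vimage_algebra (space M) (\<lambda>\<omega>. \<lambda>i\<in>{1..n}. a i \<omega>) (Pi\<^sub>M {1..n} (\<lambda>_. borel)))
          (\<lambda>\<omega>. indicator B (a (Suc n) \<omega>)) \<omega>
        = measure (uniform_measure lborel (segment (\<lambda>i. a i \<omega>) n)) B"

end

theory Submission
  imports Defs
begin

text \<open>
  Almost surely every segment has length between 1 and 2, so in each step at most one end is cut,
  and for \<open>0 \<le> x \<le> 1/2\<close> the excess \<open>R\<^sub>n = \<rho>\<^sub>n - 1/2\<close> stays above \<open>x\<close> with conditional probability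
  \<open>1 - 4x / (1 + 2R\<^sub>n)\<close> as long as \<open>R\<^sub>n > x\<close>. Since \<open>0 \<le> R\<^sub>n \<le> 1/2\<close>, this gives
  \<open>(1 - 4x)\<^sup>n \<le> P(R\<^sub>n > x) \<le> (1 - 2x)\<^sup>n\<close>. Separating the event \<open>R\<^sub>n > e\<close>, whose probability
  decays geometrically, improves the upper bound to \<open>(1 - 4x / (1 + 2e))\<^sup>n + 2x / e\<close>. Taking
  \<open>x = y / n\<close>, then \<open>n \<rightarrow> \<infinity>\<close>, then \<open>e \<rightarrow> 0\<close> gives \<open>P(n R\<^sub>n > y) \<rightarrow> exp (-4y)\<close>. The moments
  are \<open>\<integral> k y\<^sup>k\<^sup>-\<^sup>1 P(n R\<^sub>n > y) dy\<close>, and they converge by domination with \<open>exp (-2y)\<close>.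
\<close>

section \<open>Joint laws from conditional densities\<close>

text \<open>The exceptional null set in \<open>cond\<close> may depend on \<open>B\<close>, so the
  condition cannot be used pointwise in \<open>H\<close>. Integrating it over preimages under
  \<open>H\<close> removes the null sets and fixes the joint law on rectangles
  \<open>A \<times> B\<close>; these form an intersection-stable generator of the product
  sigma-algebra, which determines the joint law.\<close>

lemma (in prob_space) distr_pair_eq_density:
  fixes H :: "'a \<Rightarrow> 'b" and y :: "'a \<Rightarrow> real" and q :: "'b \<times> real \<Rightarrow> ennreal"
  assumes H [measurable]: "H \<in> M \<rightarrow>\<^sub>M N"
    and y [measurable]: "y \<in> borel_measurable M"
    and q [measurable]: "q \<in> borel_measurable (N \<Otimes>\<^sub>M lborel)"
    and cond: "\<And>B. B \<in> sets borel \<Longrightarrow>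
      AE \<omega> in M. ennreal (real_cond_exp M (vimage_algebra (space M) H N)
          (\<lambda>\<omega>. indicator B (y \<omega>)) \<omega>) = (\<integral>\<^sup>+s. q (H \<omega>, s) * indicator B s \<partial>lborel)"
  shows "distr M (N \<Otimes>\<^sub>M lborel) (\<lambda>\<omega>. (H \<omega>, y \<omega>)) = density (distr M N H \<Otimes>\<^sub>M lborel) q"
    (is "?J = ?D")
proof -
  let ?F = "vimage_algebra (space M) H N"
  have sub: "subalgebra M ?F"
    unfolding subalgebra_def by (auto simp: sets_vimage_algebra2[OF measurable_space[OF H, THEN Pi_I]])
  interpret S: finite_measure_subalgebra M ?F
    by unfold_locales (rule sub)
  interpret HN: prob_space "distr M N H"
    by (rule prob_space_distr) simp
  have [measurable_cong]: "sets (distr M N H \<Otimes>\<^sub>M lborel) = sets (N \<Otimes>\<^sub>M lborel)"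
    by (intro sets_pair_measure_cong) auto
  have rect: "emeasure ?J (A \<times> B) = emeasure ?D (A \<times> B)"
    if A [measurable]: "A \<in> sets N" and B: "B \<in> sets borel" for A B
  proof -
    note B [measurable]
    let ?g = "\<lambda>\<omega>. indicator B (y \<omega>) :: real"
    let ?V = "H -` A \<inter> space M"
    have V: "?V \<in> sets ?F" by (rule in_vimage_algebra) fact
    have [measurable]: "?V \<in> sets M" by measurable
    have intg: "integrable M ?g" by (rule integrable_const_bound[where B = 1]) auto
    have intc: "integrable M (real_cond_exp M ?F ?g)" by (rule S.real_cond_exp_int(1)[OF intg])
    have pos: "AE \<omega> in M. 0 \<le> real_cond_exp M ?F ?g \<omega>"
      by (rule S.real_cond_exp_pos) auto
    have "emeasure ?J (A \<times> B) = emeasure M ((\<lambda>\<omega>. (H \<omega>, y \<omega>)) -` (A \<times> B) \<inter> space M)"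
      by (rule emeasure_distr) auto
    also have "(\<lambda>\<omega>. (H \<omega>, y \<omega>)) -` (A \<times> B) \<inter> space M = ?V \<inter> (y -` B \<inter> space M)" by auto
    also have "emeasure M \<dots> = ennreal (\<integral>\<omega>\<in>?V. ?g \<omega> \<partial>M)"
    proof -
      have "(\<integral>\<omega>\<in>?V. ?g \<omega> \<partial>M) = (\<integral>\<omega>. indicator (?V \<inter> (y -` B \<inter> space M)) \<omega> \<partial>M)"
        unfolding set_lebesgue_integral_def by (rule Bochner_Integration.integral_cong) (auto simp: indicator_def)
      also have "\<dots> = prob (?V \<inter> (y -` B \<inter> space M))" by simp
      finally show ?thesis by (simp add: emeasure_eq_measure)
    qed
    \<comment> \<open>Defining property of conditional expectation: \<open>?V\<close> is a preimage
      under \<open>H\<close>, hence lies in the conditioning sigma-algebra.\<close>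
    also have "(\<integral>\<omega>\<in>?V. ?g \<omega> \<partial>M) = (\<integral>\<omega>\<in>?V. real_cond_exp M ?F ?g \<omega> \<partial>M)"
      by (rule S.real_cond_exp_intA[OF intg V])
    also have "ennreal \<dots> = (\<integral>\<^sup>+\<omega>. ennreal (indicator ?V \<omega> * real_cond_exp M ?F ?g \<omega>) \<partial>M)"
      unfolding set_lebesgue_integral_def real_scaleR_def
      by (intro nn_integral_eq_integral[symmetric])
         (use integrable_mult_indicator[OF \<open>?V \<in> sets M\<close> intc] pos in auto)
    also have "\<dots> = (\<integral>\<^sup>+\<omega>. indicator A (H \<omega>) * (\<integral>\<^sup>+s. q (H \<omega>, s) * indicator B s \<partial>lborel) \<partial>M)"
    proof (rule nn_integral_cong_AE)
      show "AE \<omega> in M. ennreal (indicator ?V \<omega> * real_cond_exp M ?F ?g \<omega>) =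
        indicator A (H \<omega>) * (\<integral>\<^sup>+s. q (H \<omega>, s) * indicator B s \<partial>lborel)"
        using cond[OF B] AE_space by eventually_elim (auto simp: indicator_def)
    qed
    also have "\<dots> = (\<integral>\<^sup>+h. indicator A h * (\<integral>\<^sup>+s. q (h, s) * indicator B s \<partial>lborel) \<partial>distr M N H)"
      by (subst nn_integral_distr) auto
    also have "\<dots> = (\<integral>\<^sup>+h. \<integral>\<^sup>+s. q (h, s) * indicator (A \<times> B) (h, s) \<partial>lborel \<partial>distr M N H)"
      by (intro nn_integral_cong, subst nn_integral_cmult[symmetric])
         (auto intro!: nn_integral_cong simp: indicator_def)
    also have "\<dots> = (\<integral>\<^sup>+p. q p * indicator (A \<times> B) p \<partial>(distr M N H \<Otimes>\<^sub>M lborel))"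
      by (rule lborel.nn_integral_fst) measurable
    also have "\<dots> = emeasure ?D (A \<times> B)"
      by (rule emeasure_density[symmetric]) measurable
    finally show ?thesis .
  qed
  let ?E = "{A \<times> B |A B. A \<in> sets N \<and> B \<in> sets (lborel :: real measure)}"
  show ?thesis
  \<comment> \<open>The joint law has finite total mass, so a constant sequence serves as the
    exhausting sequence.\<close>
  proof (rule measure_eqI_generator_eq[OF Int_stable_pair_measure_generator[of N lborel],
        where \<Omega> = "space N \<times> UNIV" and A = "\<lambda>_. space N \<times> UNIV"])
    show "?E \<subseteq> Pow (space N \<times> UNIV)"
      using sets.space_closed[of N] by auto
    show "emeasure ?J X = emeasure ?D X" if "X \<in> ?E" for X
      using that rect by auto
    show "sets ?J = sigma_sets (space N \<times> UNIV) ?E"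
      by (simp add: sets_pair_measure)
    show "sets ?D = sigma_sets (space N \<times> UNIV) ?E"
      by (simp add: sets_pair_measure)
    show "range (\<lambda>_::nat. space N \<times> UNIV) \<subseteq> ?E"
      by (intro image_subsetI CollectI exI[of _ "space N"] exI[of _ UNIV]) auto
    show "emeasure ?J (space N \<times> UNIV) \<noteq> \<infinity>" for i :: nat
      by (subst emeasure_distr) (auto simp: space_pair_measure)
  qed auto
qed

text \<open>With the joint density known, Tonelli evaluates an event \<open>C\<close> that couples
  \<open>y\<close> with the history \<open>H\<close>, section by section.\<close>

lemma (in prob_space) emeasure_pair_eq_nn_integral:
  fixes H :: "'a \<Rightarrow> 'b" and y :: "'a \<Rightarrow> real" and q :: "'b \<times> real \<Rightarrow> ennreal"
  assumes H [measurable]: "H \<in> M \<rightarrow>\<^sub>M N"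
    and y [measurable]: "y \<in> borel_measurable M"
    and q [measurable]: "q \<in> borel_measurable (N \<Otimes>\<^sub>M lborel)"
    and cond: "\<And>B. B \<in> sets borel \<Longrightarrow>
      AE \<omega> in M. ennreal (real_cond_exp M (vimage_algebra (space M) H N)
          (\<lambda>\<omega>. indicator B (y \<omega>)) \<omega>) = (\<integral>\<^sup>+s. q (H \<omega>, s) * indicator B s \<partial>lborel)"
    and C [measurable]: "Measurable.pred (N \<Otimes>\<^sub>M lborel) (\<lambda>(h, s). C h s)"
  shows "emeasure M {\<omega> \<in> space M. C (H \<omega>) (y \<omega>)} =
    (\<integral>\<^sup>+\<omega>. \<integral>\<^sup>+s. q (H \<omega>, s) * indicator {s. C (H \<omega>) s} s \<partial>lborel \<partial>M)"
proof -
  have [measurable_cong]: "sets (distr M N H \<Otimes>\<^sub>M lborel) = sets (N \<Otimes>\<^sub>M lborel)"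
    by (intro sets_pair_measure_cong) auto
  have joint: "distr M (N \<Otimes>\<^sub>M lborel) (\<lambda>\<omega>. (H \<omega>, y \<omega>)) =
      density (distr M N H \<Otimes>\<^sub>M lborel) q"
    by (rule distr_pair_eq_density[OF H y q cond])
  let ?C = "{p \<in> space (N \<Otimes>\<^sub>M lborel). C (fst p) (snd p)}"
  have [measurable]: "?C \<in> sets (N \<Otimes>\<^sub>M lborel)"
    using C by (simp add: case_prod_unfold pred_def)
  have "emeasure M {\<omega> \<in> space M. C (H \<omega>) (y \<omega>)} = emeasure (distr M (N \<Otimes>\<^sub>M lborel) (\<lambda>\<omega>. (H \<omega>, y \<omega>))) ?C"
    using measurable_space[OF H]
    by (subst emeasure_distr) (auto intro!: arg_cong[where f = "emeasure M"] simp: space_pair_measure)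
  also have "\<dots> = (\<integral>\<^sup>+p. q p * indicator ?C p \<partial>(distr M N H \<Otimes>\<^sub>M lborel))"
    unfolding joint by (rule emeasure_density) measurable
  also have "\<dots> = (\<integral>\<^sup>+h. \<integral>\<^sup>+s. q (h, s) * indicator ?C (h, s) \<partial>lborel \<partial>distr M N H)"
    by (rule lborel.nn_integral_fst[symmetric]) measurable
  also have "\<dots> = (\<integral>\<^sup>+\<omega>. \<integral>\<^sup>+s. q (H \<omega>, s) * indicator ?C (H \<omega>, s) \<partial>lborel \<partial>M)"
    by (rule nn_integral_distr) measurable
  also have "\<dots> = (\<integral>\<^sup>+\<omega>. \<integral>\<^sup>+s. q (H \<omega>, s) * indicator {s. C (H \<omega>) s} s \<partial>lborel \<partial>M)"
    using measurable_space[OF H]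
    by (intro nn_integral_cong) (auto simp: space_pair_measure indicator_def)
  finally show ?thesis .
qed

section \<open>Endpoint recursion for the segments\<close>

primrec segment_lo :: "(nat \<Rightarrow> real) \<Rightarrow> nat \<Rightarrow> real" where
  "segment_lo a 0 = -1"
| "segment_lo a (Suc n) = max (segment_lo a n) (a (Suc n) - 1)"

primrec segment_hi :: "(nat \<Rightarrow> real) \<Rightarrow> nat \<Rightarrow> real" where
  "segment_hi a 0 = 1"
| "segment_hi a (Suc n) = min (segment_hi a n) (a (Suc n) + 1)"

lemma segment_eq: "segment a n = {segment_lo a n..segment_hi a n}"
  by (induction n) (auto simp: min_def max_def)

text \<open>The second branch is the fixed value given to an empty segment. Keeping it yields
  measurability of the radius on the whole space, although that branch is met only on a null
  set.\<close>

lemma segment_radius_eq: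
  "segment_radius a n =
    (if segment_lo a n \<le> segment_hi a n then (segment_hi a n - segment_lo a n) / 2
     else (Sup {} - Inf {}) / 2)"
  by (simp add: segment_radius_def segment_eq)

lemma segment_lo_cong: "(\<And>i. i \<in> {1..n} \<Longrightarrow> a i = b i) \<Longrightarrow> segment_lo a n = segment_lo b n"
  by (induction n) auto

lemma segment_hi_cong: "(\<And>i. i \<in> {1..n} \<Longrightarrow> a i = b i) \<Longrightarrow> segment_hi a n = segment_hi b n"
  by (induction n) auto

lemma measurable_segment_lo:
  "(\<And>i. i \<in> {1..n} \<Longrightarrow> (\<lambda>x. f x i) \<in> borel_measurable N) \<Longrightarrow>
    (\<lambda>x. segment_lo (f x) n) \<in> borel_measurable N"
  by (induction n) auto

lemma measurable_segment_hi:
  "(\<And>i. i \<in> {1..n} \<Longrightarrow> (\<lambda>x. f x i) \<in> borel_measurable N) \<Longrightarrow>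
    (\<lambda>x. segment_hi (f x) n) \<in> borel_measurable N"
  by (induction n) auto

text \<open>Translates the uniform measure of the locale assumption into the density form expected
  by the joint-law lemmas.\<close>

lemma nn_integral_uniform_Icc_inter:
  fixes l u :: real
  assumes "l < u" "B \<in> sets borel"
  shows "(\<integral>\<^sup>+s. indicator {l..u} s / ennreal (u - l) * indicator B s \<partial>lborel) =
    ennreal (measure (uniform_measure lborel {l..u}) B)"
proof -
  interpret U: prob_space "uniform_measure lborel {l..u}"
    by (rule prob_space_uniform_measure) (use assms in auto)
  have "(\<integral>\<^sup>+s. indicator {l..u} s / ennreal (u - l) * indicator B s \<partial>lborel) =
    emeasure (density lborel (\<lambda>s. indicator {l..u} s / ennreal (u - l))) B"
    using assms by (subst emeasure_density) auto
  also have "density lborel (\<lambda>s. indicator {l..u} s / ennreal (u - l)) = uniform_measure lborel {l..u}"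
    using assms by (simp add: uniform_measure_def)
  finally show ?thesis by (simp add: U.emeasure_eq_measure)
qed

section \<open>One-step law of the radius\<close>

context diminishing_segment_process
begin

abbreviation lo :: "nat \<Rightarrow> 'w \<Rightarrow> real" where "lo n \<omega> \<equiv> segment_lo (\<lambda>i. a i \<omega>) n"
abbreviation hi :: "nat \<Rightarrow> 'w \<Rightarrow> real" where "hi n \<omega> \<equiv> segment_hi (\<lambda>i. a i \<omega>) n"
abbreviation radius :: "nat \<Rightarrow> 'w \<Rightarrow> real" where "radius n \<omega> \<equiv> segment_radius (\<lambda>i. a i \<omega>) n"

lemma measurable_lo [measurable]: "lo n \<in> borel_measurable M"
  using point_measurable by (intro measurable_segment_lo) auto

lemma measurable_hi [measurable]: "hi n \<in> borel_measurable M"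
  using point_measurable by (intro measurable_segment_hi) auto

lemma measurable_radius [measurable]: "radius n \<in> borel_measurable M"
  unfolding segment_radius_eq by measurable

text \<open>
  The uniform conditional law is assumed only for fixed Borel sets \<open>B\<close>; here the event for the new
  point may depend on the current segment.
\<close>
lemma emeasure_step:
  assumes bounds: "AE \<omega> in M. lo n \<omega> < hi n \<omega>"
    and C: "Measurable.pred (borel \<Otimes>\<^sub>M (borel \<Otimes>\<^sub>M borel)) (\<lambda>(l, u, s). C l u s)"
  shows "emeasure M {\<omega> \<in> space M. C (lo n \<omega>) (hi n \<omega>) (a (Suc n) \<omega>)} =
    (\<integral>\<^sup>+\<omega>. ennreal (measure (uniform_measure lborel {lo n \<omega>..hi n \<omega>})
       {s. C (lo n \<omega>) (hi n \<omega>) s}) \<partial>M)"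
proof -
  let ?N = "Pi\<^sub>M {1..n} (\<lambda>_. borel) :: (nat \<Rightarrow> real) measure"
  let ?l = "\<lambda>h. segment_lo h n" and ?u = "\<lambda>h. segment_hi h n"
  \<comment> \<open>\<open>H\<close> is the history map that generates the conditioning
    sigma-algebra in \<open>point_uniform\<close>; \<open>q\<close> is the uniform density on the
    current segment, written as a function of the history.\<close>
  define H where "H = (\<lambda>\<omega>. \<lambda>i\<in>{1..n}. a i \<omega>)"
  define q where "q = (\<lambda>(h, s). indicator {?l h..?u h} s / ennreal (?u h - ?l h))"
  have H [measurable]: "H \<in> M \<rightarrow>\<^sub>M ?N"
    unfolding H_def using point_measurable by (intro measurable_restrict) auto
  have y [measurable]: "a (Suc n) \<in> borel_measurable M"
    by (rule point_measurable) simp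
  have l [measurable]: "?l \<in> borel_measurable ?N"
    by (intro measurable_segment_lo) auto
  have u [measurable]: "?u \<in> borel_measurable ?N"
    by (intro measurable_segment_hi) auto
  have q: "q \<in> borel_measurable (?N \<Otimes>\<^sub>M lborel)"
  proof -
    have [measurable]: "(\<lambda>p. ?l (fst p)) \<in> borel_measurable (?N \<Otimes>\<^sub>M lborel)"
      "(\<lambda>p. ?u (fst p)) \<in> borel_measurable (?N \<Otimes>\<^sub>M lborel)"
      by (rule measurable_compose[OF measurable_fst l] measurable_compose[OF measurable_fst u])+
    show ?thesis unfolding q_def indicator_def atLeastAtMost_iff by measurable
  qed
  have lH: "?l (H \<omega>) = lo n \<omega>" for \<omega> by (rule segment_lo_cong) (auto simp: H_def)
  have uH: "?u (H \<omega>) = hi n \<omega>" for \<omega> by (rule segment_hi_cong) (auto simp: H_def)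
  have inner: "AE \<omega> in M. (\<integral>\<^sup>+s. q (H \<omega>, s) * indicator (B \<omega>) s \<partial>lborel) =
      ennreal (measure (uniform_measure lborel {lo n \<omega>..hi n \<omega>}) (B \<omega>))"
    if "\<And>\<omega>. B \<omega> \<in> sets borel" for B
    using bounds
  proof eventually_elim
    case (elim \<omega>)
    show ?case
      using nn_integral_uniform_Icc_inter[OF elim that] by (simp add: q_def lH uH)
  qed
  have cond: "AE \<omega> in M. ennreal (real_cond_exp M (vimage_algebra (space M) H ?N)
        (\<lambda>\<omega>. indicator B (a (Suc n) \<omega>)) \<omega>) = (\<integral>\<^sup>+s. q (H \<omega>, s) * indicator B s \<partial>lborel)"
    if B: "B \<in> sets borel" for B
    using point_uniform[OF B, of n] inner[of "\<lambda>_. B", OF B] unfolding H_def segment_eq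
    by eventually_elim simp
  have C' [measurable]: "Measurable.pred (?N \<Otimes>\<^sub>M lborel) (\<lambda>(h, s). C (?l h) (?u h) s)"
  proof -
    have "(\<lambda>(h, s). (?l h, ?u h, s)) \<in> (?N \<Otimes>\<^sub>M lborel) \<rightarrow>\<^sub>M (borel \<Otimes>\<^sub>M (borel \<Otimes>\<^sub>M borel))"
      by measurable
    from measurable_compose[OF this C] show ?thesis by (simp add: case_prod_unfold)
  qed
  have sect: "{s. C l u s} \<in> sets borel" for l u
  proof -
    have "Measurable.pred borel (\<lambda>s. C l u s)"
      using measurable_compose[of "\<lambda>s. (l, u, s)" borel, OF _ C] by simp
    then show ?thesis by (simp add: pred_def)
  qed
  have "emeasure M {\<omega> \<in> space M. C (?l (H \<omega>)) (?u (H \<omega>)) (a (Suc n) \<omega>)} =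
    (\<integral>\<^sup>+\<omega>. \<integral>\<^sup>+s. q (H \<omega>, s) * indicator {s. C (?l (H \<omega>)) (?u (H \<omega>)) s} s \<partial>lborel \<partial>M)"
    by (rule emeasure_pair_eq_nn_integral[OF H y q cond C'])
  also have "\<dots> = (\<integral>\<^sup>+\<omega>. ennreal (measure (uniform_measure lborel {lo n \<omega>..hi n \<omega>})
       {s. C (lo n \<omega>) (hi n \<omega>) s}) \<partial>M)"
    unfolding lH uH by (rule nn_integral_cong_AE, rule inner, rule sect)
  finally show ?thesis unfolding lH uH .
qed

text \<open>Almost surely the new point \<open>s\<close> lies in the segment \<open>[l, u]\<close>.
  Cutting both ends would need \<open>l + 1 < s < u - 1\<close>, impossible for width at most 2.
  After one cut the width is \<open>s + 1 - l\<close> or \<open>u - s + 1\<close>, so at least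
  1.\<close>

lemma AE_width: "AE \<omega> in M. lo n \<omega> + 1 \<le> hi n \<omega> \<and> hi n \<omega> \<le> lo n \<omega> + 2"
proof (induction n)
  case (Suc n)
  have [measurable]: "a (Suc n) \<in> borel_measurable M"
    by (rule point_measurable) simp
  \<comment> \<open>Missing the segment is an event about the new point that moves with the
    endpoints, which is the case \<open>emeasure_step\<close> covers.\<close>
  have "emeasure M {\<omega> \<in> space M. \<not> (lo n \<omega> \<le> a (Suc n) \<omega> \<and> a (Suc n) \<omega> \<le> hi n \<omega>)} =
    (\<integral>\<^sup>+\<omega>. ennreal (measure (uniform_measure lborel {lo n \<omega>..hi n \<omega>})
       {s. \<not> (lo n \<omega> \<le> s \<and> s \<le> hi n \<omega>)}) \<partial>M)"
    by (rule emeasure_step) (use Suc in \<open>auto elim!: eventually_mono\<close>)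
  also have "\<dots> = 0"
  proof -
    have "measure (uniform_measure lborel {l..u}) {s. \<not> (l \<le> s \<and> s \<le> u)} = 0" for l u :: real
    proof -
      have [measurable]: "{s. \<not> (l \<le> s \<and> s \<le> u)} \<in> sets borel" by measurable
      have "{l..u} \<inter> {s. \<not> (l \<le> s \<and> s \<le> u)} = {}" by auto
      then show ?thesis by (simp add: measure_def)
    qed
    then show ?thesis by simp
  qed
  finally have "AE \<omega> in M. lo n \<omega> \<le> a (Suc n) \<omega> \<and> a (Suc n) \<omega> \<le> hi n \<omega>"
    by (subst AE_iff_measurable[OF _ refl]) auto
  with Suc show ?case
    by eventually_elim auto
qed simp

lemma AE_radius: "AE \<omega> in M. radius n \<omega> = (hi n \<omega> - lo n \<omega>) / 2 \<and> 1 / 2 \<le> radius n \<omega> \<and> radius n \<omega> \<le> 1"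
  using AE_width[of n] by eventually_elim (auto simp: segment_radius_eq field_simps)

definition tail :: "nat \<Rightarrow> real \<Rightarrow> real" where
  "tail n x = prob {\<omega> \<in> space M. radius n \<omega> - 1 / 2 > x}"

text \<open>Given the segment, the excess stays above \<open>x\<close> exactly when it is above
  \<open>x\<close> already and the new point is farther than \<open>2 * x\<close> from both ends.
  The good points fill a length \<open>w - 4 * x\<close> out of the width \<open>w\<close>, which is
  twice the radius.\<close>

lemma tail_Suc:
  assumes x: "0 \<le> x" "x \<le> 1 / 2"
  shows "tail (Suc n) x =
    expectation (\<lambda>\<omega>. indicator {\<omega>. radius n \<omega> - 1 / 2 > x} \<omega> * (1 - 2 * x / radius n \<omega>))"
    (is "_ = expectation ?f")
proof -
  have [measurable]: "a (Suc n) \<in> borel_measurable M"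
    by (rule point_measurable) simp
  \<comment> \<open>The new width is the least of \<open>u - l\<close>, \<open>s + 1 - l\<close>,
    \<open>u - s + 1\<close> and 2. Requiring more than \<open>1 + 2 * x\<close> of the first three
    gives \<open>?C\<close>; the value 2 is harmless because \<open>x \<le> 1 / 2\<close> and the
    old width is at most 2.\<close>
  let ?C = "\<lambda>l u s. u - l - 1 > 2 * x \<and> l + 2 * x < s \<and> s < u - 2 * x"
  have "emeasure M {\<omega> \<in> space M. radius (Suc n) \<omega> - 1 / 2 > x} =
    emeasure M {\<omega> \<in> space M. ?C (lo n \<omega>) (hi n \<omega>) (a (Suc n) \<omega>)}"
  proof (rule emeasure_eq_AE)
    show "AE \<omega> in M. (\<omega> \<in> {\<omega> \<in> space M. radius (Suc n) \<omega> - 1 / 2 > x}) =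
      (\<omega> \<in> {\<omega> \<in> space M. ?C (lo n \<omega>) (hi n \<omega>) (a (Suc n) \<omega>)})"
      using AE_radius[of "Suc n"] AE_width[of n]
    proof eventually_elim
      case (elim \<omega>)
      then show ?case using x by (auto simp: min_def max_def field_simps split: if_splits)
    qed
  qed measurable
  also have "\<dots> = (\<integral>\<^sup>+\<omega>. ennreal (measure (uniform_measure lborel {lo n \<omega>..hi n \<omega>})
       {s. ?C (lo n \<omega>) (hi n \<omega>) s}) \<partial>M)"
    by (rule emeasure_step) (use AE_width[of n] in \<open>auto elim!: eventually_mono\<close>)
  also have "\<dots> = (\<integral>\<^sup>+\<omega>. ennreal (?f \<omega>) \<partial>M)"
  proof (rule nn_integral_cong_AE)
    show "AE \<omega> in M. ennreal (measure (uniform_measure lborel {lo n \<omega>..hi n \<omega>})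
       {s. ?C (lo n \<omega>) (hi n \<omega>) s}) = ennreal (?f \<omega>)"
      using AE_radius[of n] AE_width[of n]
    proof eventually_elim
      case (elim \<omega>)
      let ?l = "lo n \<omega>" and ?u = "hi n \<omega>"
      show ?case
      proof (cases "?u - ?l - 1 > 2 * x")
        case True
        have eq: "{s. ?C ?l ?u s} = {?l + 2 * x<..<?u - 2 * x}" using True by auto
        have "measure (uniform_measure lborel {?l..?u}) {s. ?C ?l ?u s} =
            measure lborel {?l + 2 * x<..<?u - 2 * x} / measure lborel {?l..?u}"
        proof -
          have "{?l..?u} \<inter> {?l + 2 * x<..<?u - 2 * x} = {?l + 2 * x<..<?u - 2 * x}"
            using x by auto
          then show ?thesis
            unfolding eq using elim by (subst measure_uniform_measure) auto
        qed
        \<comment> \<open>The interval has nonnegative length: the width exceeds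
          \<open>1 + 2 * x\<close>, and \<open>4 * x \<le> 1 + 2 * x\<close> for
          \<open>x \<le> 1 / 2\<close>.\<close>
        also have "\<dots> = (?u - ?l - 4 * x) / (?u - ?l)"
          using True x elim by simp
        also have "\<dots> = ?f \<omega>"
        proof -
          have w: "?u - ?l = 2 * radius n \<omega>" and "radius n \<omega> > 0" using elim by auto
          with True show ?thesis unfolding w by (simp add: field_simps)
        qed
        finally show ?thesis by simp
      next
        case False
        then have "{s. ?C ?l ?u s} = {}" by auto
        then show ?thesis using False elim by simp
      qed
    qed
  qed
  also have "\<dots> = ennreal (expectation ?f)"
  proof (rule nn_integral_eq_integral)
    show "AE \<omega> in M. 0 \<le> ?f \<omega>"
      using AE_radius[of n] by eventually_elim (use x in \<open>auto simp: indicator_def field_simps\<close>)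
    show "integrable M ?f"
    proof (rule integrable_const_bound[where B = 1])
      show "AE \<omega> in M. norm (?f \<omega>) \<le> 1"
        using AE_radius[of n] by eventually_elim (use x in \<open>auto simp: indicator_def field_simps\<close>)
    qed measurable
  qed
  finally have "ennreal (tail (Suc n) x) = ennreal (expectation ?f)"
    by (simp add: tail_def emeasure_eq_measure)
  moreover have "0 \<le> expectation ?f"
  proof (rule integral_nonneg_AE)
    show "AE \<omega> in M. 0 \<le> ?f \<omega>"
      using AE_radius[of n] by eventually_elim (use x in \<open>auto simp: indicator_def field_simps\<close>)
  qed
  ultimately show ?thesis by (simp add: tail_def)
qed

end

section \<open>Analytic tools: a perturbed recursion and moment integrals\<close>

text \<open>Unrolling the recursion, the error made at step \<open>i\<close> is damped by a power of
  \<open>q\<close>, which is at most 1, so all errors together stay below the geometric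
  series.\<close>

lemma geometric_perturbation_bound:
  fixes p :: "nat \<Rightarrow> real"
  assumes step: "\<And>n. p (Suc n) \<le> q * p n + c * r ^ n"
    and "p 0 \<le> 1" "0 \<le> q" "q \<le> 1" "0 \<le> c" "0 \<le> r" "r < 1"
  shows "p n \<le> q ^ n + c / (1 - r)"
proof -
  \<comment> \<open>The partial sum leaves room for the next error; the limiting constant would not
    be inductive.\<close>
  have "p n \<le> q ^ n + c * (\<Sum>i<n. r ^ i)"
  proof (induction n)
    case (Suc n)
    have "p (Suc n) \<le> q * (q ^ n + c * (\<Sum>i<n. r ^ i)) + c * r ^ n"
      using step[of n] mult_left_mono[OF Suc \<open>0 \<le> q\<close>] by linarith
    also have "\<dots> \<le> q ^ Suc n + 1 * (c * (\<Sum>i<n. r ^ i)) + c * r ^ n"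
      unfolding distrib_left power_Suc
      using assms by (intro add_mono mult_right_mono mult_nonneg_nonneg sum_nonneg) auto
    also have "\<dots> = q ^ Suc n + c * (\<Sum>i<Suc n. r ^ i)" by (simp add: algebra_simps)
    finally show ?case .
  qed (use assms in simp)
  also have "(\<Sum>i<n. r ^ i) \<le> 1 / (1 - r)"
    using assms by (simp add: sum_gp_strict divide_right_mono)
  finally show ?thesis using assms by (simp add: mult_left_mono)
qed

text \<open>Layer-cake formula: write a power as the integral of its derivative and exchange the
  integrals by Tonelli. The exchange is done with nonnegative integrals; \<open>int\<close> supplies
  the finiteness for returning to real ones.\<close>

lemma (in prob_space) expectation_power_eq_integral_tail:
  fixes X :: "'a \<Rightarrow> real"
  assumes X [measurable]: "X \<in> borel_measurable M"
    and nonneg: "AE \<omega> in M. 0 \<le> X \<omega>"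
    and k: "k \<ge> 1"
    and int: "integrable lborel
      (\<lambda>y. indicator {0..} y * (real k * y ^ (k - 1) * prob {\<omega> \<in> space M. X \<omega> > y}))"
  shows "expectation (\<lambda>\<omega>. X \<omega> ^ k) =
    (\<integral>y. indicator {0..} y * (real k * y ^ (k - 1) * prob {\<omega> \<in> space M. X \<omega> > y}) \<partial>lborel)"
    (is "_ = integral\<^sup>L lborel ?g")
proof -
  let ?h = "\<lambda>y. real k * y ^ (k - 1)"
  \<comment> \<open>The half-open interval matches the strict inequality in the tail; the endpoint
    \<open>x\<close> is a null set. Since \<open>k \<ge> 1\<close>, the boundary term
    \<open>0 ^ k\<close> vanishes.\<close>
  have power: "ennreal (x ^ k) = (\<integral>\<^sup>+y. ennreal (?h y) * indicator {0..<x} y \<partial>lborel)" if "0 \<le> x" for x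
  proof -
    have "(\<integral>\<^sup>+y. ennreal (?h y) * indicator {0..<x} y \<partial>lborel) =
      (\<integral>\<^sup>+y. ennreal (?h y) * indicator {0..x} y \<partial>lborel)"
    proof (rule nn_integral_cong_AE)
      have "AE y in lborel. y \<noteq> x" by (rule AE_lborel_singleton)
      then show "AE y in lborel. ennreal (?h y) * indicator {0..<x} y = ennreal (?h y) * indicator {0..x} y"
        by eventually_elim (auto simp: indicator_def)
    qed
    also have "\<dots> = ennreal (x ^ k - 0 ^ k)"
      by (rule nn_integral_FTC_Icc)
         (use that in \<open>auto intro!: derivative_eq_intros simp: has_real_derivative_iff_has_vector_derivative[symmetric]\<close>)
    finally show ?thesis using k by (simp add: power_0_left)
  qed
  have "(\<integral>\<^sup>+\<omega>. ennreal (X \<omega> ^ k) \<partial>M) =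
    (\<integral>\<^sup>+\<omega>. \<integral>\<^sup>+y. ennreal (?h y) * (if 0 \<le> y \<and> y < X \<omega> then 1 else 0) \<partial>lborel \<partial>M)"
  proof (rule nn_integral_cong_AE)
    show "AE \<omega> in M. ennreal (X \<omega> ^ k) =
        (\<integral>\<^sup>+y. ennreal (?h y) * (if 0 \<le> y \<and> y < X \<omega> then 1 else 0) \<partial>lborel)"
      using nonneg by eventually_elim
        (simp add: power, rule nn_integral_cong, auto simp: indicator_def)
  qed
  also have "\<dots> = (\<integral>\<^sup>+y. \<integral>\<^sup>+\<omega>. ennreal (?h y) * (if 0 \<le> y \<and> y < X \<omega> then 1 else 0) \<partial>M \<partial>lborel)"
  proof -
    interpret pair_sigma_finite lborel M ..
    show ?thesis by (rule Fubini') measurable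
  qed
  also have "\<dots> = (\<integral>\<^sup>+y. ennreal (?g y) \<partial>lborel)"
  proof (rule nn_integral_cong)
    fix y :: real
    show "(\<integral>\<^sup>+\<omega>. ennreal (?h y) * (if 0 \<le> y \<and> y < X \<omega> then 1 else 0) \<partial>M) = ennreal (?g y)"
    proof (cases "0 \<le> y")
      case True
      have "(\<integral>\<^sup>+\<omega>. ennreal (?h y) * (if 0 \<le> y \<and> y < X \<omega> then 1 else 0) \<partial>M) =
        (\<integral>\<^sup>+\<omega>. ennreal (?h y) * indicator {\<omega> \<in> space M. X \<omega> > y} \<omega> \<partial>M)"
        using True by (intro nn_integral_cong) (auto simp: indicator_def)
      also have "\<dots> = ennreal (?h y) * emeasure M {\<omega> \<in> space M. X \<omega> > y}"
        by (rule nn_integral_cmult_indicator) measurable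
      also have "\<dots> = ennreal (?g y)"
        using True by (simp add: emeasure_eq_measure ennreal_mult)
      finally show ?thesis .
    qed simp
  qed
  also have "\<dots> = ennreal (integral\<^sup>L lborel ?g)"
    by (rule nn_integral_eq_integral[OF int]) (auto simp: indicator_def)
  finally have "(\<integral>\<^sup>+\<omega>. ennreal (X \<omega> ^ k) \<partial>M) = ennreal (integral\<^sup>L lborel ?g)" .
  then show ?thesis
  proof (subst integral_eq_nn_integral)
    show "AE \<omega> in M. 0 \<le> X \<omega> ^ k" using nonneg by eventually_elim simp
    show "enn2real (\<integral>\<^sup>+\<omega>. ennreal (X \<omega> ^ k) \<partial>M) = integral\<^sup>L lborel ?g"
      if "(\<integral>\<^sup>+\<omega>. ennreal (X \<omega> ^ k) \<partial>M) = ennreal (integral\<^sup>L lborel ?g)"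
      unfolding that by (intro enn2real_ennreal integral_nonneg_AE) (auto simp: indicator_def)
  qed measurable
qed

text \<open>This is the \<open>k\<close>-th moment of the exponential law with rate
  \<open>l\<close>, i.e. Erlang of shape index 0, divided by the factor \<open>l\<close> of its
  density.\<close>

lemma has_bochner_integral_power_times_exponential:
  fixes l :: real
  assumes "0 < l"
  shows "has_bochner_integral lborel (\<lambda>y. indicator {0..} y * (y ^ k * exp (- (l * y)))) (fact k / l ^ Suc k)"
proof (rule has_bochner_integral_nn_integral)
  have "(\<integral>\<^sup>+y. ennreal (indicator {0..} y * (y ^ k * exp (- (l * y)))) \<partial>lborel) =
    (\<integral>\<^sup>+y. ennreal (1 / l) * ennreal (erlang_density 0 l y * y ^ k) \<partial>lborel)"
    using assms by (intro nn_integral_cong)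
      (auto simp: erlang_density_def indicator_def ennreal_mult[symmetric] field_simps)
  also have "\<dots> = ennreal (1 / l) * ennreal (fact k / l ^ k)"
    using assms nn_integral_erlang_ith_moment[of l 0 k] by (subst nn_integral_cmult) auto
  also have "\<dots> = ennreal (fact k / l ^ Suc k)"
    using assms by (simp add: ennreal_mult[symmetric] field_simps)
  finally show "(\<integral>\<^sup>+y. ennreal (indicator {0..} y * (y ^ k * exp (- (l * y)))) \<partial>lborel) =
    ennreal (fact k / l ^ Suc k)" .
qed (use assms in \<open>auto simp: indicator_def\<close>)

section \<open>Tail estimates for the excess radius\<close>

context diminishing_segment_process
begin

lemma tail_nonneg: "0 \<le> tail n x" and tail_le_1: "tail n x \<le> 1"
  by (simp_all add: tail_def)

lemma tail_0: "x < 1 / 2 \<Longrightarrow> tail 0 x = 1"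
  by (simp add: tail_def segment_radius_eq prob_space)

lemma tail_eq_0:
  assumes "1 / 2 \<le> x"
  shows "tail n x = 0"
  unfolding tail_def
proof (subst prob_eq_0)
  show "AE \<omega> in M. \<omega> \<notin> {\<omega> \<in> space M. radius n \<omega> - 1 / 2 > x}"
    using AE_radius[of n] by eventually_elim (use assms in auto)
qed measurable

lemma expectation_indicator_radius:
  "expectation (\<lambda>\<omega>. indicator {\<omega>. radius n \<omega> - 1 / 2 > x} \<omega> * c) = c * tail n x"
proof -
  have "expectation (\<lambda>\<omega>. indicator {\<omega>. radius n \<omega> - 1 / 2 > x} \<omega> * c) =
    expectation (\<lambda>\<omega>. c * indicator {\<omega> \<in> space M. radius n \<omega> - 1 / 2 > x} \<omega>)"
    by (intro Bochner_Integration.integral_cong) (auto simp: indicator_def)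
  then show ?thesis by (simp add: tail_def)
qed

lemma integrable_tail_step:
  assumes x: "0 \<le> x" "x \<le> 1 / 2"
  shows "integrable M (\<lambda>\<omega>. indicator {\<omega>. radius n \<omega> - 1 / 2 > x} \<omega> * (1 - 2 * x / radius n \<omega>))"
proof (rule integrable_const_bound[where B = 1])
  show "AE \<omega> in M. norm (indicator {\<omega>. radius n \<omega> - 1 / 2 > x} \<omega> * (1 - 2 * x / radius n \<omega>)) \<le> 1"
    using AE_radius[of n] by eventually_elim (use x in \<open>auto simp: indicator_def field_simps\<close>)
qed measurable

lemma integrable_indicator_radius:
  "integrable M (\<lambda>\<omega>. indicator {\<omega>. radius n \<omega> - 1 / 2 > x} \<omega> * (c :: real))"
  by (rule integrable_const_bound[where B = "\<bar>c\<bar>"]) (auto simp: indicator_def)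

text \<open>Since the radius is at least 1/2, the loss \<open>2 * x / radius\<close> is at most
  \<open>4 * x\<close>. This already has the correct limiting rate 4.\<close>

lemma tail_Suc_ge:
  assumes x: "0 \<le> x" "x \<le> 1 / 2"
  shows "(1 - 4 * x) * tail n x \<le> tail (Suc n) x"
  unfolding tail_Suc[OF x] expectation_indicator_radius[symmetric]
proof (rule integral_mono_AE[OF integrable_indicator_radius integrable_tail_step[OF x]])
  show "AE \<omega> in M. indicator {\<omega>. radius n \<omega> - 1 / 2 > x} \<omega> * (1 - 4 * x)
    \<le> indicator {\<omega>. radius n \<omega> - 1 / 2 > x} \<omega> * (1 - 2 * x / radius n \<omega>)"
    using AE_radius[of n]
  proof eventually_elim
    case (elim \<omega>)
    then have "2 * x / radius n \<omega> \<le> 2 * x / (1 / 2)"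
      using x by (intro divide_left_mono) auto
    then show ?case by (auto simp: indicator_def)
  qed
qed

text \<open>Since the radius is at most 1, the loss is at least \<open>2 * x\<close>. Rate 2 is too
  weak for the limit, but gives geometric decay at a fixed level and the domination for the
  moments.\<close>

lemma tail_Suc_le:
  assumes x: "0 \<le> x" "x \<le> 1 / 2"
  shows "tail (Suc n) x \<le> (1 - 2 * x) * tail n x"
  unfolding tail_Suc[OF x] expectation_indicator_radius[symmetric]
proof (rule integral_mono_AE[OF integrable_tail_step[OF x] integrable_indicator_radius])
  show "AE \<omega> in M. indicator {\<omega>. radius n \<omega> - 1 / 2 > x} \<omega> * (1 - 2 * x / radius n \<omega>)
    \<le> indicator {\<omega>. radius n \<omega> - 1 / 2 > x} \<omega> * (1 - 2 * x)"
    using AE_radius[of n]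
  proof eventually_elim
    case (elim \<omega>)
    then have "2 * x / 1 \<le> 2 * x / radius n \<omega>"
      using x by (intro divide_left_mono) auto
    then show ?case by (auto simp: indicator_def)
  qed
qed

text \<open>While the excess is at most \<open>e\<close>, twice the radius is at most
  \<open>1 + 2 * e\<close>, so the loss is at least \<open>4 * x / (1 + 2 * e)\<close>. When the
  excess is above \<open>e\<close> this may fail, but by at most \<open>4 * x\<close>, charged to
  the event of probability \<open>tail n e\<close>.\<close>

lemma tail_Suc_le_split:
  assumes x: "0 \<le> x" "x \<le> 1 / 2" and e: "0 < e"
  shows "tail (Suc n) x \<le> (1 - 4 * x / (1 + 2 * e)) * tail n x + 4 * x * tail n e"
  unfolding tail_Suc[OF x] expectation_indicator_radius[symmetric]
proof (subst Bochner_Integration.integral_add[symmetric, OF integrable_indicator_radius integrable_indicator_radius],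
    rule integral_mono_AE[OF integrable_tail_step[OF x]])
  show "AE \<omega> in M. indicator {\<omega>. radius n \<omega> - 1 / 2 > x} \<omega> * (1 - 2 * x / radius n \<omega>)
    \<le> indicator {\<omega>. radius n \<omega> - 1 / 2 > x} \<omega> * (1 - 4 * x / (1 + 2 * e)) +
      indicator {\<omega>. radius n \<omega> - 1 / 2 > e} \<omega> * (4 * x)"
    using AE_radius[of n]
  proof eventually_elim
    case (elim \<omega>)
    have "0 \<le> 2 * x / radius n \<omega>" using x elim by auto
    moreover have "4 * x / (1 + 2 * e) \<le> 4 * x / 1"
      using x e by (intro divide_left_mono) auto
    moreover have "4 * x / (1 + 2 * e) \<le> 2 * x / radius n \<omega>" if "radius n \<omega> - 1 / 2 \<le> e"
    proof -
      have "4 * x / (1 + 2 * e) \<le> 4 * x / (2 * radius n \<omega>)"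
        using x e elim that by (intro divide_left_mono mult_pos_pos) auto
      then show ?thesis by simp
    qed
    ultimately show ?case using x by (auto simp: indicator_def)
  qed
qed (intro Bochner_Integration.integrable_add integrable_indicator_radius)

lemma tail_ge:
  assumes "0 \<le> x" "x \<le> 1 / 4"
  shows "(1 - 4 * x) ^ n \<le> tail n x"
proof (induction n)
  case (Suc n)
  have "(1 - 4 * x) ^ Suc n \<le> (1 - 4 * x) * tail n x"
    using mult_left_mono[OF Suc, of "1 - 4 * x"] assms by simp
  also have "\<dots> \<le> tail (Suc n) x" using assms by (intro tail_Suc_ge) auto
  finally show ?case .
qed (use assms in \<open>simp add: tail_0\<close>)

lemma tail_le:
  assumes "0 \<le> x" "x \<le> 1 / 2"
  shows "tail n x \<le> (1 - 2 * x) ^ n"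
proof (induction n)
  case (Suc n)
  have "tail (Suc n) x \<le> (1 - 2 * x) * tail n x" using assms by (rule tail_Suc_le)
  also have "\<dots> \<le> (1 - 2 * x) ^ Suc n"
    using mult_left_mono[OF Suc, of "1 - 2 * x"] assms by simp
  finally show ?case .
qed (simp add: tail_le_1)

lemma tail_le_split:
  assumes x: "0 \<le> x" "x \<le> 1 / 4" and e: "0 < e" "e \<le> 1 / 2"
  shows "tail n x \<le> (1 - 4 * x / (1 + 2 * e)) ^ n + 2 * x / e"
proof -
  \<comment> \<open>Error size \<open>4 * x\<close> and ratio \<open>1 - 2 * e\<close>, the latter
    from the rate-2 bound at level \<open>e\<close>.\<close>
  have "tail n x \<le> (1 - 4 * x / (1 + 2 * e)) ^ n + 4 * x / (1 - (1 - 2 * e))"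
  proof (rule geometric_perturbation_bound)
    fix n
    have "tail (Suc n) x \<le> (1 - 4 * x / (1 + 2 * e)) * tail n x + 4 * x * tail n e"
      using x e by (intro tail_Suc_le_split) auto
    also have "\<dots> \<le> (1 - 4 * x / (1 + 2 * e)) * tail n x + 4 * x * (1 - 2 * e) ^ n"
      using x e by (intro add_left_mono mult_left_mono tail_le) auto
    finally show "tail (Suc n) x \<le> (1 - 4 * x / (1 + 2 * e)) * tail n x + 4 * x * (1 - 2 * e) ^ n" .
    show "0 \<le> 1 - 4 * x / (1 + 2 * e)" using x e by (simp add: field_simps)
  qed (use x e in \<open>auto simp: tail_le_1\<close>)
  then show ?thesis by simp
qed

text \<open>A bound uniform in \<open>n\<close>, later the integrable majorant. Beyond
  \<open>y / n = 1/2\<close> the tail is zero, as the excess never exceeds 1/2 almost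
  surely.\<close>

lemma tail_scaled_le:
  assumes "0 \<le> y" "n \<ge> 1"
  shows "tail n (y / real n) \<le> exp (- (2 * y))"
proof (cases "y / real n \<le> 1 / 2")
  case True
  have "tail n (y / real n) \<le> (1 - 2 * (y / real n)) ^ n"
    using True assms by (intro tail_le) auto
  also have "\<dots> \<le> exp (- (2 * (y / real n))) ^ n"
    by (intro power_mono) (use True exp_ge_add_one_self[of "- (2 * (y / real n))"] in linarith)+
  also have "\<dots> = exp (- (2 * y))"
    using assms by (simp add: exp_of_nat_mult[symmetric])
  finally show ?thesis .
next
  case False
  then show ?thesis by (simp add: tail_eq_0)
qed

lemma tail_scaled_tendsto:
  assumes y: "0 \<le> y"
  shows "(\<lambda>n. tail n (y / real n)) \<longlonglongrightarrow> exp (- (4 * y))"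
proof (rule order_tendstoI)
  have small: "\<forall>\<^sub>F n in sequentially. n \<ge> 1 \<and> y / real n \<le> 1 / 4"
  proof -
    have "(\<lambda>n. y / real n) \<longlonglongrightarrow> 0" by (rule lim_const_over_n)
    then have "\<forall>\<^sub>F n in sequentially. y / real n < 1 / 4" by (rule order_tendstoD) simp
    with eventually_ge_at_top[of 1] show ?thesis by eventually_elim auto
  qed
  {
    fix c assume "c < exp (- (4 * y))"
    then have "\<forall>\<^sub>F n in sequentially. c < (1 + - (4 * y) / real n) ^ n"
      by (intro order_tendstoD(1)[OF tendsto_exp_limit_sequentially])
    with small show "\<forall>\<^sub>F n in sequentially. c < tail n (y / real n)"
    proof eventually_elim
      case (elim n)
      have "(1 - 4 * (y / real n)) ^ n \<le> tail n (y / real n)"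
        using elim y by (intro tail_ge) auto
      with elim show ?case by simp
    qed
  next
    fix c assume c: "exp (- (4 * y)) < c"
    \<comment> \<open>The order of limits matters: \<open>e\<close> is fixed first, by continuity at
      0, so that the correction \<open>2 * y / (e * n)\<close> then vanishes as \<open>n\<close>
      grows.\<close>
    have "((\<lambda>e. exp (- (4 * y) / (1 + 2 * e))) \<longlongrightarrow> exp (- (4 * y) / (1 + 2 * 0))) (at_right 0)"
      by (intro tendsto_intros) auto
    then have "((\<lambda>e. exp (- (4 * y) / (1 + 2 * e))) \<longlongrightarrow> exp (- (4 * y))) (at_right 0)" by simp
    then have "\<forall>\<^sub>F e in at_right 0. exp (- (4 * y) / (1 + 2 * e)) < c"
      by (rule order_tendstoD) fact
    moreover have "\<forall>\<^sub>F e in at_right 0. e \<in> {0<..<1 / 2 :: real}"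
      by (rule eventually_at_right_real) simp
    ultimately have "\<forall>\<^sub>F e in at_right 0. exp (- (4 * y) / (1 + 2 * e)) < c \<and> e \<in> {0<..<1 / 2}"
      by eventually_elim simp
    then obtain e where e: "exp (- (4 * y) / (1 + 2 * e)) < c" "0 < e" "e < 1 / 2"
      using eventually_happens'[OF trivial_limit_at_right_real] by fastforce
    have "(\<lambda>n. (1 + (- (4 * y) / (1 + 2 * e)) / real n) ^ n + (2 * y / e) / real n)
        \<longlonglongrightarrow> exp (- (4 * y) / (1 + 2 * e)) + 0"
      by (intro tendsto_add tendsto_exp_limit_sequentially lim_const_over_n)
    then have "\<forall>\<^sub>F n in sequentially.
        (1 + (- (4 * y) / (1 + 2 * e)) / real n) ^ n + (2 * y / e) / real n < c"
      by (rule order_tendstoD) (use e in simp)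
    with small show "\<forall>\<^sub>F n in sequentially. tail n (y / real n) < c"
    proof eventually_elim
      case (elim n)
      have "tail n (y / real n) \<le> (1 - 4 * (y / real n) / (1 + 2 * e)) ^ n + 2 * (y / real n) / e"
        using elim y e by (intro tail_le_split) auto
      also have "\<dots> = (1 + (- (4 * y) / (1 + 2 * e)) / real n) ^ n + (2 * y / e) / real n"
        by (simp add: mult.commute)
      finally show ?case using elim by simp
    qed
  }
qed

section \<open>Convergence in distribution and of moments\<close>

lemma scaled_tail:
  assumes "n \<ge> 1"
  shows "prob {\<omega> \<in> space M. real n * (radius n \<omega> - 1 / 2) > y} = tail n (y / real n)"
proof -
  have "y < real n * r \<longleftrightarrow> y / real n < r" for r
    using assms by (simp add: field_simps)
  then show ?thesis by (simp add: tail_def)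
qed

text \<open>The limit cdf is continuous, so convergence is shown at every \<open>y\<close>: by
  complementing the tail for \<open>y \<ge> 0\<close>, and trivially for \<open>y < 0\<close>, where
  both sides vanish.\<close>

lemma weak_conv_scaled_radius:
  "weak_conv_m (\<lambda>n. distr M borel (\<lambda>\<omega>. real n * (radius n \<omega> - 1 / 2)))
     (density lborel (\<lambda>x. ennreal (exponential_density 4 x)))"
  unfolding weak_conv_m_def weak_conv_def
proof (intro allI impI)
  fix y :: real
  let ?X = "\<lambda>n \<omega>. real n * (radius n \<omega> - 1 / 2)"
  have cdf: "cdf (distr M borel (?X n)) y = prob {\<omega> \<in> space M. ?X n \<omega> \<le> y}" for n
    unfolding cdf_def by (subst measure_distr) (auto intro!: arg_cong[where f = prob])
  have lim: "cdf (density lborel (\<lambda>x. ennreal (exponential_density 4 x))) y =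
      (if 0 \<le> y then 1 - exp (- (4 * y)) else 0)"
    unfolding cdf_def measure_def by (simp add: emeasure_erlang_density erlang_CDF_0)
  show "(\<lambda>n. cdf (distr M borel (?X n)) y) \<longlonglongrightarrow>
      cdf (density lborel (\<lambda>x. ennreal (exponential_density 4 x))) y"
  proof (cases "0 \<le> y")
    case True
    have "(\<lambda>n. 1 - tail n (y / real n)) \<longlonglongrightarrow> 1 - exp (- (4 * y))"
      by (intro tendsto_diff tendsto_const tail_scaled_tendsto True)
    moreover have "\<forall>\<^sub>F n in sequentially. 1 - tail n (y / real n) = cdf (distr M borel (?X n)) y"
      using eventually_ge_at_top[of 1]
    proof eventually_elim
      case (elim n)
      show ?case
        unfolding cdf scaled_tail[OF elim, symmetric]
        by (subst prob_compl[symmetric]) (auto intro!: arg_cong[where f = prob])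
    qed
    ultimately show ?thesis using True unfolding lim by (simp add: Lim_transform_eventually)
  next
    case False
    have "prob {\<omega> \<in> space M. ?X n \<omega> \<le> y} = 0" for n
    proof (subst prob_eq_0)
      show "AE \<omega> in M. \<omega> \<notin> {\<omega> \<in> space M. ?X n \<omega> \<le> y}"
        using AE_radius[of n]
      proof eventually_elim
        case (elim \<omega>)
        then have "0 \<le> ?X n \<omega>" by simp
        with False show ?case by simp
      qed
    qed measurable
    then show ?thesis using False by (simp add: lim cdf)
  qed
qed

text \<open>Layer-cake turns the moment into an integral of \<open>k * y ^ (k - 1)\<close> against
  the scaled tail; dominated convergence with the rate-2 majorant \<open>?G 2\<close> leads to the
  rate-4 integral \<open>?G 4\<close>.\<close>

lemma moments_scaled_radius:
  assumes k: "k \<ge> 1"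
  shows "(\<lambda>n. expectation (\<lambda>\<omega>. (real n * (radius n \<omega> - 1 / 2)) ^ k)) \<longlonglongrightarrow> fact k / 4 ^ k"
proof -
  let ?X = "\<lambda>n \<omega>. real n * (radius n \<omega> - 1 / 2)"
  let ?h = "\<lambda>y :: real. real k * y ^ (k - 1)"
  let ?g = "\<lambda>n y. indicator {0..} y * (?h y * tail n (y / real n)) :: real"
  let ?G = "\<lambda>l y. real k * (indicator {0..} y * (y ^ (k - 1) * exp (- (l * y)))) :: real"
  have meas [measurable]: "tail n \<in> borel_measurable borel" for n
  proof -
    \<comment> \<open>Writing the tail as the measure of sections of a product-measurable set makes
      it measurable in the level.\<close>
    have "(\<lambda>x. prob {\<omega> \<in> space M. (x, \<omega>) \<in> {p \<in> space (borel \<Otimes>\<^sub>M M). radius n (snd p) - 1 / 2 > fst p}})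
        \<in> borel_measurable borel"
      by measurable
    also have "(\<lambda>x. prob {\<omega> \<in> space M. (x, \<omega>) \<in> {p \<in> space (borel \<Otimes>\<^sub>M M). radius n (snd p) - 1 / 2 > fst p}}) = tail n"
      by (auto simp: tail_def fun_eq_iff space_pair_measure intro!: arg_cong[where f = prob])
    finally show ?thesis .
  qed
  have intG: "integrable lborel (?G l)" "integral\<^sup>L lborel (?G l) = fact k / l ^ k" if "0 < l" for l
  proof -
    have "has_bochner_integral lborel (?G l) (real k * (fact (k - 1) / l ^ Suc (k - 1)))"
      using has_bochner_integral_power_times_exponential[OF that]
      by (rule has_bochner_integral_mult_right)
    moreover have "real k * (fact (k - 1) / l ^ Suc (k - 1)) = fact k / l ^ k"
      using k by (cases k) auto
    ultimately show "integrable lborel (?G l)" "integral\<^sup>L lborel (?G l) = fact k / l ^ k"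
      by (auto simp: has_bochner_integral_iff)
  qed
  have bound: "norm (?g n y) \<le> ?G 2 y" if "n \<ge> 1" for n y
    using tail_scaled_le[OF _ that, of y] tail_nonneg[of n "y / real n"]
    by (auto simp: indicator_def abs_mult mult.assoc intro!: mult_left_mono)
  have intg: "integrable lborel (?g n)" if "n \<ge> 1" for n
  proof (rule Bochner_Integration.integrable_bound[OF intG(1)[of 2]])
    show "AE y in lborel. norm (?g n y) \<le> norm (?G 2 y)"
      by (intro AE_I2 order_trans[OF bound[OF that]]) simp
  qed auto
  have moment: "expectation (\<lambda>\<omega>. ?X n \<omega> ^ k) = integral\<^sup>L lborel (?g n)" if n: "n \<ge> 1" for n
  proof -
    have "AE \<omega> in M. 0 \<le> ?X n \<omega>" using AE_radius[of n] by eventually_elim auto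
    from expectation_power_eq_integral_tail[OF _ this k] intg[OF n] show ?thesis
      unfolding scaled_tail[OF n] by simp
  qed
  have "(\<lambda>n. integral\<^sup>L lborel (?g (Suc n))) \<longlonglongrightarrow> integral\<^sup>L lborel (?G 4)"
  proof (rule integral_dominated_convergence[where w = "?G 2"])
    show "AE y in lborel. (\<lambda>n. ?g (Suc n) y) \<longlonglongrightarrow> ?G 4 y"
    proof (rule AE_I2)
      fix y :: real
      show "(\<lambda>n. ?g (Suc n) y) \<longlonglongrightarrow> ?G 4 y"
      proof (cases "0 \<le> y")
        case True
        have "(\<lambda>n. ?h y * tail (Suc n) (y / real (Suc n))) \<longlonglongrightarrow> ?h y * exp (- (4 * y))"
          by (intro tendsto_mult tendsto_const LIMSEQ_Suc[OF tail_scaled_tendsto] True)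
        then show ?thesis using True by (simp add: mult.assoc)
      qed simp
    qed
    show "AE y in lborel. norm (?g (Suc n) y) \<le> ?G 2 y" for n
      using bound[of "Suc n"] by auto
  qed (use intG(1)[of 2] in auto)
  moreover have "integral\<^sup>L lborel (?G 4) = fact k / 4 ^ k" by (rule intG(2)) simp
  moreover have "(\<lambda>n. expectation (\<lambda>\<omega>. ?X (Suc n) \<omega> ^ k)) = (\<lambda>n. integral\<^sup>L lborel (?g (Suc n)))"
    by (rule ext, rule moment) simp
  ultimately have "(\<lambda>n. expectation (\<lambda>\<omega>. ?X (Suc n) \<omega> ^ k)) \<longlonglongrightarrow> fact k / 4 ^ k"
    by (simp only:)
  then show ?thesis by (rule LIMSEQ_imp_Suc)
qed

end

theorem theorem1:
  fixes M :: "'w measure" and a :: "nat \<Rightarrow> 'w \<Rightarrow> real"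
  assumes "diminishing_segment_process M a"
  defines "\<rho> \<equiv> \<lambda>n \<omega>. segment_radius (\<lambda>i. a i \<omega>) n"
  shows "weak_conv_m
           (\<lambda>n. distr M borel (\<lambda>\<omega>. real n * (\<rho> n \<omega> - 1 / 2)))
           (density lborel (\<lambda>x. ennreal (exponential_density 4 x)))
       \<and> (\<forall>k\<ge>1. (\<lambda>n. prob_space.expectation M (\<lambda>\<omega>. real n ^ k * (\<rho> n \<omega> - 1 / 2) ^ k))
             \<longlonglongrightarrow> fact k / 4 ^ k)"
proof -
  interpret diminishing_segment_process M a by fact
  show ?thesis
    unfolding \<rho>_def power_mult_distrib[symmetric]
    using weak_conv_scaled_radius moments_scaled_radius by blast
qed

end
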